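(* Let $N\ge 1$, let $\epsilon_1,\dots,\epsilon_N\in\mathbb{R}$ with $\ell:=\max_k|\epsilon_k|<\frac14$, and let $\boldsymbol{V}$ be the $N\times N$ Vandermonde matrix with nodes $z_k=e^{2\pi i(k+\epsilon_k)/N}$, $k=1,\dots,N$, i.e. $\boldsymbol{V}=[z_k^{\,j}]_{0\le j<N,\,1\le k\le N}$. Then $\boldsymbol{V}$ is invertible and its extreme singular values satisfy $$\sigma_N(\boldsymbol{V})\ge\sqrt{N}\,\big(\cos(\pi\ell)-\sin(\pi\ell)\big)\quad\text{and}\quad\sigma_1(\boldsymbol{V})\le\sqrt{N}\,\big(2-\cos(\pi\ell)+\sin(\pi\ell)\big).$$
   Context: $\sigma_1(\boldsymbol V)$ and $\sigma_N(\boldsymbol V)$ denote the largest and smallest singular values of the $N\times N$ matrix $\boldsymbol V$. *)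

theory Defs
  imports Complex_Main
    "Jordan_Normal_Form.Schur_Decomposition"
    "Jordan_Normal_Form.Spectral_Radius"
begin

text \<open>Nodes are numbered \<open>z 1, \<dots>, z n\<close>, whereas \<^const>\<open>mat\<close> counts rows and columns from \<open>0\<close>:
  column \<open>k\<close> belongs to the node \<open>z (Suc k)\<close>, row \<open>j\<close> carries the powers \<open>z\<^sup>j\<close>.\<close>

definition vandermonde_mat :: "nat \<Rightarrow> (nat \<Rightarrow> complex) \<Rightarrow> complex mat" where
  "vandermonde_mat n z = mat n n (\<lambda>(j, k). z (Suc k) ^ j)"

text \<open>The singular values of \<open>A\<close> are the nonnegative square roots of the eigenvalues of
  \<open>A\<^sup>* A\<close>. Multiplicities are dropped, as they do not affect the extreme singular values. For a
  matrix with fewer rows than columns some conventions omit \<open>0\<close> values that are included here;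
  for square matrices all conventions agree.\<close>

definition singular_values :: "complex mat \<Rightarrow> real set" where
  "singular_values A = {s. 0 \<le> s \<and> eigenvalue (mat_adjoint A * A) (complex_of_real (s\<^sup>2))}"

definition largest_singular_value :: "complex mat \<Rightarrow> real" where
  "largest_singular_value A = Max (singular_values A)"

definition smallest_singular_value :: "complex mat \<Rightarrow> real" where
  "smallest_singular_value A = Min (singular_values A)"

text \<open>\<^const>\<open>Max\<close> and \<^const>\<open>Min\<close> are only meaningful on finite nonempty sets.\<close>

lemma finite_singular_values:
  assumes A: "A \<in> carrier_mat m n"
  shows "finite (singular_values A)"
proof -
  have "mat_adjoint A * A \<in> carrier_mat n n"
    using A unfolding mat_adjoint_def by auto
  then have "finite (spectrum (mat_adjoint A * A))"
    by (rule card_finite_spectrum)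
  then have "finite ((\<lambda>\<mu>. sqrt (Re \<mu>)) ` spectrum (mat_adjoint A * A))"
    by (rule finite_imageI)
  moreover have "singular_values A \<subseteq> (\<lambda>\<mu>. sqrt (Re \<mu>)) ` spectrum (mat_adjoint A * A)"
  proof
    fix s assume "s \<in> singular_values A"
    then have "0 \<le> s" "complex_of_real (s\<^sup>2) \<in> spectrum (mat_adjoint A * A)"
      by (auto simp: singular_values_def spectrum_def)
    then show "s \<in> (\<lambda>\<mu>. sqrt (Re \<mu>)) ` spectrum (mat_adjoint A * A)"
      by (intro image_eqI[of _ _ "complex_of_real (s\<^sup>2)"]) auto
  qed
  ultimately show ?thesis by (rule rev_finite_subset)
qed

lemma singular_values_nonempty:
  assumes A: "A \<in> carrier_mat m n" and n: "n > 0"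
  shows "singular_values A \<noteq> {}"
proof -
  let ?H = "mat_adjoint A"
  have H: "?H \<in> carrier_mat n m" using A unfolding mat_adjoint_def by auto
  have B: "?H * A \<in> carrier_mat n n" using A H by auto
  from spectrum_non_empty[OF B n] obtain \<mu> where ev: "eigenvalue (?H * A) \<mu>"
    by (auto simp: spectrum_def)
  then obtain v where "eigenvector (?H * A) v \<mu>"
    by (auto simp: eigenvalue_def)
  then have v: "v \<in> carrier_vec n" "v \<noteq> 0\<^sub>v n" and eq: "(?H * A) *\<^sub>v v = \<mu> \<cdot>\<^sub>v v"
    using H by (simp_all add: eigenvector_def)
  let ?w = "A *\<^sub>v v"
  have w: "?w \<in> carrier_vec m" using A v by auto
  have entry: "?H $$ (i, j) = cnj (A $$ (j, i))" if "i < n" "j < m" for i j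
    using that A unfolding mat_adjoint_def by (simp add: mat_of_rows_def)
  have mv: "(B *\<^sub>v x) $ i = (\<Sum>j<c. B $$ (i, j) * x $ j)"
    if "B \<in> carrier_mat r c" "x \<in> carrier_vec c" "i < r"
    for B :: "complex mat" and x r c i
    using that by (auto simp: scalar_prod_def lessThan_atLeast0)
  have wi: "?w $ j = (\<Sum>i<n. A $$ (j, i) * v $ i)" if "j < m" for j
    by (rule mv[OF A v(1) that])
  have "?H *\<^sub>v ?w = \<mu> \<cdot>\<^sub>v v" using eq A H v by (simp add: assoc_mult_mat_vec)
  then have Hw: "(\<Sum>j<m. cnj (A $$ (j, i)) * ?w $ j) = \<mu> * v $ i" if "i < n" for i
  proof -
    have "(?H *\<^sub>v ?w) $ i = (\<Sum>j<m. ?H $$ (i, j) * ?w $ j)"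
      by (rule mv[OF H w that])
    with \<open>?H *\<^sub>v ?w = \<mu> \<cdot>\<^sub>v v\<close> show ?thesis using that v entry by simp
  qed
  let ?p = "\<Sum>j<m. (cmod (?w $ j))\<^sup>2" and ?q = "\<Sum>i<n. (cmod (v $ i))\<^sup>2"
  have "complex_of_real ?p = (\<Sum>j<m. cnj (?w $ j) * ?w $ j)"
    unfolding of_real_sum complex_norm_square by (simp add: mult.commute)
  also have "\<dots> = (\<Sum>j<m. \<Sum>i<n. cnj (v $ i) * (cnj (A $$ (j, i)) * ?w $ j))"
    by (rule sum.cong) (simp_all add: wi sum_distrib_right sum_distrib_left mult_ac del: index_mult_mat_vec)
  also have "\<dots> = (\<Sum>i<n. cnj (v $ i) * (\<Sum>j<m. cnj (A $$ (j, i)) * ?w $ j))"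
    by (subst sum.swap) (simp only: sum_distrib_left)
  also have "\<dots> = (\<Sum>i<n. cnj (v $ i) * (\<mu> * v $ i))"
    by (rule sum.cong) (simp_all only: Hw lessThan_iff)
  also have "\<dots> = \<mu> * complex_of_real ?q"
    unfolding of_real_sum complex_norm_square sum_distrib_left by (simp add: mult_ac)
  finally have pq: "complex_of_real ?p = \<mu> * complex_of_real ?q" .
  have "?q \<noteq> 0"
  proof
    assume "?q = 0"
    then have "\<forall>i<n. v $ i = 0" by (subst (asm) sum_nonneg_eq_0_iff) auto
    then have "v = 0\<^sub>v n" using v by (intro eq_vecI) auto
    with v show False by simp
  qed
  then have mu: "\<mu> = complex_of_real (?p / ?q)" using pq
    by (simp add: nonzero_eq_divide_eq del: of_real_sum)
  have "0 \<le> ?p / ?q" by (intro divide_nonneg_nonneg sum_nonneg) auto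
  then have "\<mu> = complex_of_real ((sqrt (?p / ?q))\<^sup>2)"
    unfolding mu by (simp only: real_sqrt_pow2)
  with ev \<open>0 \<le> ?p / ?q\<close> have "sqrt (?p / ?q) \<in> singular_values A"
    unfolding singular_values_def by (metis (mono_tags, lifting) mem_Collect_eq real_sqrt_ge_zero)
  then show ?thesis by blast
qed

end

theory Submission
  imports Defs "HOL-Analysis.L2_Norm"
begin

text \<open>
The theorem is a finite version of Kadec's 1/4-theorem, and the proof carries Kadec's argument over to
a grid.

Multiplying the columns of \<open>V\<close> by numbers of modulus \<open>1\<close> replaces the exponents \<open>0, \<dots>, N - 1\<close> by exponents
symmetric about \<open>0\<close> (\<open>vandermonde_entry\<close>) and changes no singular value. The new entries are
\<open>exp (\<i> k x) exp (\<i> \<epsilon>\<^sub>k x)\<close>, where \<open>x\<close> runs through \<open>N\<close> points of \<open>(-\<pi>, \<pi>)\<close>. The first factors alone form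
\<open>sqrt N\<close> times a unitary matrix (\<open>fourier_matrix_isometry\<close>). It therefore suffices to show that the
matrix with entries \<open>exp (\<i> k x) (exp (\<i> \<epsilon>\<^sub>k x) - 1)\<close> has norm at most \<open>sqrt N B\<close>, where
\<open>B = 1 - cos (\<pi> l) + sin (\<pi> l)\<close>: then \<open>sqrt N (1 - B) \<parallel>c\<parallel> \<le> \<parallel>V c\<parallel> \<le> sqrt N (1 + B) \<parallel>c\<parallel>\<close>, and
\<open>1 - B > 0\<close> since \<open>l < 1/4\<close>.

Write \<open>exp (\<i> \<delta> x) - 1 = \<i> sin (\<delta> x) - (1 - cos (\<delta> x))\<close>, and expand the even part in the exponentials
\<open>exp (\<i> n x)\<close>, the odd part in \<open>exp (\<i> (n + 1/2) x)\<close>. The continuous proof uses infinite Fourier series. Here a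
discrete Fourier transform on \<open>2N\<close> points, which include \<open>x = - \<pi>\<close>, gives finite expansions with explicit
coefficients (\<open>one_minus_cos_expansion\<close>, \<open>sin_expansion\<close>). Two properties of the coefficients
survive from the continuous case. For \<open>0 \<le> \<delta> < 1/4\<close> they have the sign \<open>(-1)\<^sup>n\<close>, so that evaluation
at \<open>x = - \<pi>\<close> yields the sum of their absolute values: \<open>1 - cos (\<pi> \<delta>)\<close> for the even part and
\<open>sin (\<pi> \<delta>)\<close> for the odd part (\<open>sum_cos_coeff\<close>, \<open>sum_sin_coeff\<close>). And their absolute values are largest at
\<open>\<bar>\<delta>\<bar> = l\<close> (\<open>cos_coeff_mono\<close>, \<open>sin_coeff_mono\<close>). Each term of an expansion multiplies the Fourier matrix
by one diagonal matrix on either side, so the norms of the terms add up to at most \<open>sqrt N B\<close>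
(\<open>L2_set_multiplier_bound\<close>).
\<close>

section \<open>Fourier expansion on an equispaced grid\<close>

text \<open>The grid consists of the \<open>2N\<close> equispaced points of \<open>[-\<pi>, \<pi>)\<close>. The odd-numbered ones,
\<open>\<pi> (2j + 1 - N) / N\<close> for \<open>j < N\<close>, are the row exponents \<open>j\<close> of the Vandermonde matrix, centred at
\<open>0\<close> and scaled by \<open>2\<pi> / N\<close>. The refinement by a factor of two brings in the end point
\<open>- \<pi>\<close>, at which the expansions below add up with all signs equal.\<close>

definition grid :: "nat \<Rightarrow> nat \<Rightarrow> real" where
  "grid N m = pi * (real m - real N) / real N"

lemma cis_minus_one: "cis (2 * h) - 1 = 2 * \<i> * complex_of_real (sin h) * cis h"
proof -
  have "cis (2 * h) - 1 = (cis h - cis (- h)) * cis h"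
    by (simp add: algebra_simps cis_mult)
  also have "cis h - cis (- h) = 2 * \<i> * complex_of_real (sin h)"
    by (simp add: complex_eq_iff)
  finally show ?thesis .
qed

text \<open>A telescoping sum: multiplication by \<open>cis (2h) - 1\<close>, where \<open>2h\<close> is the phase step from one grid point
to the next, leaves the difference of the phases at the two ends \<open>\<plusminus>\<pi>\<close>.\<close>

lemma sum_cis_grid:
  assumes N: "N > 0" and s: "sin (pi * \<alpha> / (2 * real N)) \<noteq> 0"
  shows "(\<Sum>m<2 * N. cis (\<alpha> * grid N m)) =
    complex_of_real (sin (pi * \<alpha>)) * (complex_of_real (cot (pi * \<alpha> / (2 * real N))) - \<i>)"
proof -
  define h where "h = pi * \<alpha> / (2 * real N)"
  define S where "S = (\<Sum>m<2 * N. cis (\<alpha> * grid N m))"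
  have step: "cis (\<alpha> * grid N m) * (cis (2 * h) - 1) = cis (\<alpha> * grid N (Suc m)) - cis (\<alpha> * grid N m)" for m
  proof -
    have "\<alpha> * grid N m + 2 * h = \<alpha> * grid N (Suc m)"
      using N by (simp add: grid_def h_def field_simps)
    then show ?thesis by (simp add: algebra_simps cis_mult)
  qed
  have "S * (cis (2 * h) - 1) = (\<Sum>m<2 * N. cis (\<alpha> * grid N (Suc m)) - cis (\<alpha> * grid N m))"
    unfolding S_def sum_distrib_right by (simp only: step)
  also have "\<dots> = cis (\<alpha> * grid N (2 * N)) - cis (\<alpha> * grid N 0)"
    by (rule sum_lessThan_telescope)
  also have "\<dots> = 2 * \<i> * complex_of_real (sin (pi * \<alpha>))"
    using N by (simp add: grid_def complex_eq_iff mult.commute)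
  finally have "S * complex_of_real (sin h) * cis h = complex_of_real (sin (pi * \<alpha>))"
    unfolding cis_minus_one by (simp add: mult_ac)
  then have "S * complex_of_real (sin h) * (cis h * cis (- h)) = complex_of_real (sin (pi * \<alpha>)) * cis (- h)"
    by (simp only: mult.assoc[symmetric])
  then have "S * complex_of_real (sin h) = complex_of_real (sin (pi * \<alpha>)) * cis (- h)"
    by (simp add: cis_mult)
  moreover have "cis (- h) = complex_of_real (sin h) * (complex_of_real (cot h) - \<i>)"
    using s by (simp add: h_def complex_eq_iff cot_def)
  ultimately have "S * complex_of_real (sin h) =
      (complex_of_real (sin (pi * \<alpha>)) * (complex_of_real (cot h) - \<i>)) * complex_of_real (sin h)"
    by (simp add: mult_ac)
  moreover have "complex_of_real (sin h) \<noteq> 0" using s by (simp add: h_def)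
  ultimately show ?thesis unfolding S_def h_def by simp
qed

lemma sum_roots_of_unity:
  fixes q :: int
  assumes q: "\<bar>q\<bar> < int M"
  shows "(\<Sum>n<M. cis (real n * (2 * pi * real_of_int q / real M))) = (if q = 0 then of_nat M else 0)"
proof (cases "q = 0")
  case False
  define t where "t = 2 * pi * real_of_int q / real M"
  have M: "M > 0" using q by linarith
  have ne: "cis t \<noteq> 1"
  proof
    assume "cis t = 1"
    then have "cos t = 1" by (simp add: complex_eq_iff)
    then obtain n :: int where "t = n * 2 * pi" by (auto simp: cos_one_2pi_int)
    then have "real_of_int q = real_of_int n * real M" using M by (simp add: t_def field_simps)
    then have "q = n * int M" by (metis of_int_eq_iff of_int_mult of_int_of_nat_eq)
    with q False show False
      by (metis abs_mult abs_of_nat dvd_imp_le_int dvd_triv_right linorder_not_le)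
  qed
  have "real M * t = 2 * pi * real_of_int q" using M by (simp add: t_def)
  then have "cis t ^ M = 1" by (simp only: DeMoivre) (simp add: cis_multiple_2pi)
  then have "(\<Sum>n<M. cis t ^ n) = 0" using ne by (simp add: geometric_sum)
  with False show ?thesis by (simp add: DeMoivre t_def)
qed simp

text \<open>Discrete Fourier inversion, with all frequencies shifted by \<open>\<tau>\<close>. The shift only multiplies the
orthogonality relations by unimodular factors. The case \<open>\<tau> = 0\<close> serves the even function \<open>cos (\<delta> x)\<close>,
whose periodic extension is continuous, and \<open>\<tau> = 1/2\<close> the odd function \<open>sin (\<delta> x)\<close>, whose
antiperiodic extension is continuous.\<close>

lemma grid_fourier_inversion:
  assumes p: "p < 2 * N"
  shows "f p = (\<Sum>n<2 * N. (\<Sum>m<2 * N. f m * cis (- ((real n + \<tau>) * grid N m))) / of_nat (2 * N)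
    * cis ((real n + \<tau>) * grid N p))"
proof -
  have N: "N > 0" using p by simp
  have orth: "(\<Sum>n<2 * N. cis (- ((real n + \<tau>) * grid N m)) * cis ((real n + \<tau>) * grid N p))
      = (if m = p then of_nat (2 * N) else 0)" if m: "m < 2 * N" for m
  proof -
    have "cis (- ((real n + \<tau>) * grid N m)) * cis ((real n + \<tau>) * grid N p) =
      cis (\<tau> * (grid N p - grid N m)) * cis (real n * (2 * pi * real_of_int (int p - int m) / real (2 * N)))" for n
    proof -
      have "- ((real n + \<tau>) * grid N m) + (real n + \<tau>) * grid N p =
        \<tau> * (grid N p - grid N m) + real n * (2 * pi * real_of_int (int p - int m) / real (2 * N))"
        using N by (simp add: grid_def field_simps)
      then show ?thesis by (simp only: cis_mult)
    qed
    then have "(\<Sum>n<2 * N. cis (- ((real n + \<tau>) * grid N m)) * cis ((real n + \<tau>) * grid N p)) =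
      cis (\<tau> * (grid N p - grid N m)) * (\<Sum>n<2 * N. cis (real n * (2 * pi * real_of_int (int p - int m) / real (2 * N))))"
      by (simp only: sum_distrib_left)
    also have "(\<Sum>n<2 * N. cis (real n * (2 * pi * real_of_int (int p - int m) / real (2 * N)))) =
       (if int p - int m = 0 then of_nat (2 * N) else 0)"
      using m p by (intro sum_roots_of_unity) linarith
    finally show ?thesis by auto
  qed
  have "(\<Sum>n<2 * N. (\<Sum>m<2 * N. f m * cis (- ((real n + \<tau>) * grid N m))) / of_nat (2 * N)
      * cis ((real n + \<tau>) * grid N p))
    = (\<Sum>n<2 * N. \<Sum>m<2 * N. f m / of_nat (2 * N) *
        (cis (- ((real n + \<tau>) * grid N m)) * cis ((real n + \<tau>) * grid N p)))"
    by (simp add: sum_divide_distrib sum_distrib_right mult.assoc)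
  also have "\<dots> = (\<Sum>m<2 * N. f m / of_nat (2 * N) * (\<Sum>n<2 * N.
        cis (- ((real n + \<tau>) * grid N m)) * cis ((real n + \<tau>) * grid N p)))"
    by (subst sum.swap) (simp only: sum_distrib_left)
  also have "\<dots> = (\<Sum>m<2 * N. if m = p then f m else 0)"
    using N by (intro sum.cong) (auto simp: orth)
  finally show ?thesis using p by simp
qed

text \<open>The common factor of the Fourier coefficients, at frequency \<open>\<nu>\<close>, of \<open>1 - cos (\<delta> x)\<close> and
\<open>\<i> sin (\<delta> x)\<close> on the grid. As \<open>N\<close> grows it tends to \<open>\<delta> / (\<pi> (\<nu>\<^sup>2 - \<delta>\<^sup>2))\<close>, which is
the factor in the classical Fourier series.\<close>

definition kadec_weight :: "nat \<Rightarrow> real \<Rightarrow> real \<Rightarrow> real" where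
  "kadec_weight N \<delta> \<nu> = sin (pi * \<delta> / real N) /
     (4 * real N * ((sin (pi * \<nu> / (2 * real N)))\<^sup>2 - (sin (pi * \<delta> / (2 * real N)))\<^sup>2))"

lemma sin_add_times_sin_diff: "sin (a + b) * sin (a - b) = (sin a)\<^sup>2 - (sin b)\<^sup>2" for a b :: real
proof -
  have "(sin a)\<^sup>2 - (sin b)\<^sup>2 = (sin a)\<^sup>2 * ((sin b)\<^sup>2 + (cos b)\<^sup>2) - (sin b)\<^sup>2 * ((sin a)\<^sup>2 + (cos a)\<^sup>2)"
    by simp
  also have "\<dots> = sin (a + b) * sin (a - b)"
    unfolding sin_add sin_diff by (simp only: algebra_simps power2_eq_square)
  finally show ?thesis by simp
qed

text \<open>By the closed form for exponential sums, the two exponentials contribute \<open>cot (a - b)\<close> and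
\<open>cot (a + b)\<close>, and the imaginary parts \<open>- \<i>\<close> of the closed form cancel. The hypothesis on \<open>\<sigma>\<close> is
what makes them cancel; it holds for the cosine (\<open>\<sigma> = 1\<close>) at integer frequencies and for the
sine (\<open>\<sigma> = -1\<close>) at half-integer ones.\<close>

lemma sum_grid_pair:
  assumes N: "N > 0" and ne: "(sin (pi * \<nu> / (2 * real N)))\<^sup>2 \<noteq> (sin (pi * \<delta> / (2 * real N)))\<^sup>2"
    and \<sigma>: "\<sigma> * sin (pi * (\<delta> + \<nu>)) = sin (pi * (\<delta> - \<nu>))"
  shows "(\<Sum>m<2 * N. (cis (\<delta> * grid N m) + complex_of_real \<sigma> * cis (- (\<delta> * grid N m))) * cis (- (\<nu> * grid N m)))
    = complex_of_real (- 4 * real N * sin (pi * (\<delta> - \<nu>)) * kadec_weight N \<delta> \<nu>)"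
proof -
  define a where "a = pi * \<delta> / (2 * real N)"
  define b where "b = pi * \<nu> / (2 * real N)"
  define D where "D = (sin b)\<^sup>2 - (sin a)\<^sup>2"
  have D: "D \<noteq> 0" using ne by (simp add: D_def a_def b_def)
  have prod: "sin (a + b) * sin (a - b) = - D" by (simp add: sin_add_times_sin_diff D_def)
  with D have nz: "sin (a + b) \<noteq> 0" "sin (a - b) \<noteq> 0" by auto
  have nz': "sin (- a - b) \<noteq> 0" using nz(1) sin_minus[of "a + b"] by simp
  have w: "kadec_weight N \<delta> \<nu> = sin (a + b + (a - b)) / (4 * real N * D)"
    by (simp add: kadec_weight_def D_def a_def b_def)
  have cotm: "cot (- (a + b)) = - cot (a + b)" unfolding cot_def cos_minus sin_minus by simp
  have ab: "pi * (\<delta> - \<nu>) / (2 * real N) = a - b" "pi * (- \<delta> - \<nu>) / (2 * real N) = - (a + b)"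
    using N by (simp_all add: a_def b_def field_simps)
  have neg: "sin (pi * (- \<delta> - \<nu>)) = - sin (pi * (\<delta> + \<nu>))"
    by (simp flip: sin_minus add: algebra_simps)
  have "(\<Sum>m<2 * N. (cis (\<delta> * grid N m) + complex_of_real \<sigma> * cis (- (\<delta> * grid N m))) * cis (- (\<nu> * grid N m)))
    = (\<Sum>m<2 * N. cis ((\<delta> - \<nu>) * grid N m)) + complex_of_real \<sigma> * (\<Sum>m<2 * N. cis ((- \<delta> - \<nu>) * grid N m))"
    unfolding sum_distrib_left sum.distrib[symmetric]
    by (intro sum.cong refl) (simp add: algebra_simps cis_mult)
  also have "\<dots> = complex_of_real (sin (pi * (\<delta> - \<nu>))) * (complex_of_real (cot (a - b)) - \<i>)
     + complex_of_real \<sigma> * (complex_of_real (- sin (pi * (\<delta> + \<nu>))) * (complex_of_real (cot (- (a + b))) - \<i>))"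
    by (subst (1 2) sum_cis_grid) (use N nz nz' in \<open>simp_all add: ab neg\<close>)
  also have "\<dots> = complex_of_real (sin (pi * (\<delta> - \<nu>))) * (complex_of_real (cot (a - b)) - \<i>)
     - complex_of_real (\<sigma> * sin (pi * (\<delta> + \<nu>))) * (complex_of_real (cot (- (a + b))) - \<i>)"
    by simp
  also have "\<dots> = complex_of_real (sin (pi * (\<delta> - \<nu>)) * (cot (a - b) + cot (a + b)))"
    unfolding \<sigma> cotm by (simp add: ring_distribs)
  also have "cot (a - b) + cot (a + b) = sin (a + b + (a - b)) / (sin (a + b) * sin (a - b))"
    unfolding sin_add[of "a + b" "a - b"] cot_def using nz by (simp add: field_simps)
  also have "\<dots> = - 4 * real N * kadec_weight N \<delta> \<nu>"
    unfolding prod w using N D by simp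
  finally show ?thesis by (simp add: mult_ac)
qed

lemma sin_pi_frac_mono:
  assumes N: "N > 0" and d: "0 \<le> d" "d \<le> l" "l < 1 / 2"
  shows "0 \<le> sin (pi * d / real N)" "sin (pi * d / real N) \<le> sin (pi * l / real N)"
proof -
  have N1: "1 \<le> real N" using N by simp
  show "0 \<le> sin (pi * d / real N)" "sin (pi * d / real N) \<le> sin (pi * l / real N)"
    using N1 d by (auto intro!: sin_ge_zero sin_monotone_2pi_le simp: field_simps intro: order_trans[of _ 0])
qed

text \<open>The denominators of the coefficients are positive and decrease in \<open>\<delta> \<ge> 0\<close>: modulo reflection at \<open>\<pi>/2\<close>,
the angle \<open>\<pi> \<nu> / (2N)\<close> is at least \<open>\<pi> / (4N)\<close>, which exceeds \<open>\<pi> l / (2N)\<close>.\<close>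

lemma sin_sq_gap:
  assumes N: "N > 0" and \<nu>: "1 / 2 \<le> \<nu>" "\<nu> \<le> 2 * real N - 1 / 2" and d: "0 \<le> d" "d \<le> l" "l < 1 / 2"
  shows "0 < (sin (pi * \<nu> / (2 * real N)))\<^sup>2 - (sin (pi * l / (2 * real N)))\<^sup>2"
    and "(sin (pi * d / (2 * real N)))\<^sup>2 \<le> (sin (pi * l / (2 * real N)))\<^sup>2"
proof -
  have N1: "1 \<le> real N" using N by simp
  have "sin (pi * l / (2 * real N)) < sin (pi * (1 / 2) / (2 * real N))"
    using N1 d by (intro sin_monotone_2pi) (auto simp: field_simps intro: order_trans[of _ 0])
  moreover have "sin (pi * (1 / 2) / (2 * real N)) \<le> sin (pi * \<nu> / (2 * real N))"
  proof (cases "\<nu> \<le> real N")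
    case True
    then show ?thesis
      using N1 \<nu> by (intro sin_monotone_2pi_le) (auto simp: field_simps intro: order_trans[of _ 0])
  next
    case False
    have "pi * (1 / 2) / (2 * real N) \<le> pi * (2 * real N - \<nu>) / (2 * real N)"
      using \<nu> by (intro divide_right_mono mult_left_mono) auto
    then have "sin (pi * (1 / 2) / (2 * real N)) \<le> sin (pi * (2 * real N - \<nu>) / (2 * real N))"
      using N1 False by (intro sin_monotone_2pi_le) (auto simp: field_simps intro: order_trans[of _ 0])
    also have "pi * (2 * real N - \<nu>) / (2 * real N) = pi - pi * \<nu> / (2 * real N)"
      using N1 by (simp add: field_simps)
    finally show ?thesis by (simp only: sin_pi_minus)
  qed
  moreover have "0 \<le> sin (pi * d / (2 * real N))" "sin (pi * d / (2 * real N)) \<le> sin (pi * l / (2 * real N))"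
    using N1 d by (auto intro!: sin_ge_zero sin_monotone_2pi_le simp: field_simps intro: order_trans[of _ 0])
  ultimately show "0 < (sin (pi * \<nu> / (2 * real N)))\<^sup>2 - (sin (pi * l / (2 * real N)))\<^sup>2"
    "(sin (pi * d / (2 * real N)))\<^sup>2 \<le> (sin (pi * l / (2 * real N)))\<^sup>2"
    by (auto intro: power_strict_mono power_mono)
qed


section \<open>The coefficients and their monotonicity\<close>

text \<open>This is \<open>n tan x \<le> tan (n x)\<close> with the denominators cleared, so that it also covers
\<open>n x = \<pi> / 2\<close>.\<close>

lemma mult_sin_cos_le:
  fixes x :: real
  assumes "0 \<le> x" "real n * x \<le> pi / 2"
  shows "real n * sin x * cos (real n * x) \<le> sin (real n * x) * cos x"
  using assms(2)
proof (induction n)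
  case (Suc n)
  have le: "real n * x \<le> real (Suc n) * x" using assms(1) by (simp add: algebra_simps)
  have nx: "0 \<le> real n * x" "real n * x \<le> pi / 2" using assms(1) le Suc.prems by auto
  show ?case
  proof (cases "n = 0")
    case False
    have x: "x \<le> pi / 2"
    proof -
      have "1 * x \<le> real n * x" using False assms(1) by (intro mult_right_mono) auto
      then show ?thesis using nx by simp
    qed
    have "real n * sin x * cos (real (Suc n) * x) \<le> real n * sin x * cos (real n * x)"
    proof (intro mult_left_mono)
      show "cos (real (Suc n) * x) \<le> cos (real n * x)"
        using nx le Suc.prems by (intro cos_monotone_0_pi_le) auto
      show "0 \<le> real n * sin x" using assms(1) x by (auto intro!: mult_nonneg_nonneg sin_ge_zero)
    qed
    also have "\<dots> \<le> sin (real n * x) * cos x" using Suc.IH nx by simp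
    also have "\<dots> \<le> sin (real n * x)"
      using nx by (intro mult_left_le sin_ge_zero) auto
    also have "sin (real n * x) = sin (real (Suc n) * x) * cos x - cos (real (Suc n) * x) * sin x"
      unfolding sin_diff[symmetric] by (simp add: algebra_simps)
    finally show ?thesis by (simp add: algebra_simps)
  qed simp
qed simp

text \<open>The only monotonicity that needs \<open>l \<le> 1/4\<close>, because here the factor \<open>cos (\<pi> d)\<close> decreases. The
derivative in \<open>t = \<pi> d\<close> is nonnegative since \<open>N tan (t/N) tan t \<le> (tan t)\<^sup>2 \<le> 1\<close> for
\<open>0 \<le> t \<le> \<pi>/4\<close>.\<close>

lemma sin_frac_cos_mono:
  assumes N: "N > 0" and d: "0 \<le> d" "d \<le> l" "l \<le> 1 / 4"
  shows "cos (pi * d) * sin (pi * d / real N) \<le> cos (pi * l) * sin (pi * l / real N)"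
proof (rule DERIV_nonneg_imp_nondecreasing[OF d(2)])
  fix y assume y: "d \<le> y" "y \<le> l"
  define x where "x = pi * y / real N"
  have N1: "1 \<le> real N" using N by simp
  have x: "0 \<le> x" and Nx: "real N * x = pi * y" using y d N by (auto simp: x_def)
  have py: "0 \<le> pi * y" "pi * y \<le> pi / 4" using y d by auto
  have "x \<le> real N * x" using x N1 by (simp add: mult_le_cancel_right1)
  then have x4: "x \<le> pi / 4" unfolding Nx using py(2) by (rule order_trans)
  have sc: "sin (pi * y) \<le> cos (pi * y)"
  proof -
    have "sin (pi * y) \<le> sin (pi / 4)"
      using py by (intro sin_monotone_2pi_le) (auto intro: order_trans[of _ 0])
    also have "\<dots> = cos (pi / 4)" by (simp add: sin_45 cos_45)
    also have "\<dots> \<le> cos (pi * y)" using py by (intro cos_monotone_0_pi_le) auto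
    finally show ?thesis .
  qed
  have "real N * sin x * sin (pi * y) \<le> real N * sin x * cos (pi * y)"
    using sc x x4 by (intro mult_left_mono mult_nonneg_nonneg sin_ge_zero) auto
  also have "\<dots> \<le> sin (pi * y) * cos x"
    using mult_sin_cos_le[of x N] x py Nx by simp
  also have "\<dots> \<le> cos (pi * y) * cos x"
    using sc x x4 by (intro mult_right_mono cos_ge_zero) auto
  finally have "0 \<le> pi / real N * (cos (pi * y) * cos x - real N * sin x * sin (pi * y))"
    by simp
  also have "\<dots> = cos (pi * y) * (cos x * (pi / real N)) - sin (pi * y) * pi * sin x"
    using N by (simp add: field_simps)
  finally have nonneg: "0 \<le> \<dots>" .
  have "((\<lambda>y. cos (pi * y) * sin (pi * y / real N)) has_real_derivative
     cos (pi * y) * (cos x * (pi / real N)) - sin (pi * y) * pi * sin x) (at y)"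
    unfolding x_def using N by (auto intro!: derivative_eq_intros)
  with nonneg show "\<exists>v. ((\<lambda>y. cos (pi * y) * sin (pi * y / real N)) has_real_derivative v) (at y) \<and> 0 \<le> v"
    by blast
qed

text \<open>The Fourier coefficients of \<open>1 - cos (\<delta> x)\<close> at the frequencies \<open>n\<close> and of \<open>\<i> sin (\<delta> x)\<close> at
\<open>n + 1/2\<close>, with the sign \<open>(-1)\<^sup>n\<close> removed. The mean value, \<open>n = 0\<close>, is kept as a sum because its
sign and monotonicity can be read off term by term.\<close>

definition cos_coeff :: "nat \<Rightarrow> real \<Rightarrow> nat \<Rightarrow> real" where
  "cos_coeff N \<delta> n = (if n = 0 then (\<Sum>m<2 * N. 1 - cos (\<delta> * grid N m)) / real (2 * N)
     else sin (pi * \<delta>) * kadec_weight N \<delta> (real n))"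

definition sin_coeff :: "nat \<Rightarrow> real \<Rightarrow> nat \<Rightarrow> real" where
  "sin_coeff N \<delta> n = cos (pi * \<delta>) * kadec_weight N \<delta> (real n + 1 / 2)"

lemma sin_sq_ne:
  assumes "N > 0" "1 / 2 \<le> \<nu>" "\<nu> \<le> 2 * real N - 1 / 2" "\<bar>\<delta>\<bar> < 1 / 2"
  shows "(sin (pi * \<nu> / (2 * real N)))\<^sup>2 \<noteq> (sin (pi * \<delta> / (2 * real N)))\<^sup>2"
proof -
  have "(sin (pi * \<delta> / (2 * real N)))\<^sup>2 = (sin (pi * \<bar>\<delta>\<bar> / (2 * real N)))\<^sup>2"
    by (cases "\<delta> \<ge> 0") auto
  then show ?thesis using sin_sq_gap(1)[OF assms(1-3), of "\<bar>\<delta>\<bar>" "\<bar>\<delta>\<bar>"] assms(4) by simp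
qed

lemma cis_add_minus: "cis t + cis (- t) = complex_of_real (2 * cos t)"
  by (simp add: complex_eq_iff)

lemma sin_pi_add_nat: "sin (pi * (\<delta> + real n)) = (-1) ^ n * sin (pi * \<delta>)"
  "cos (pi * (\<delta> + real n)) = (-1) ^ n * cos (pi * \<delta>)"
  by (simp_all add: distrib_left sin_add cos_add)

lemma sin_pi_diff_nat: "sin (pi * (\<delta> - real n)) = (-1) ^ n * sin (pi * \<delta>)"
  "cos (pi * (\<delta> - real n)) = (-1) ^ n * cos (pi * \<delta>)"
  by (simp_all add: right_diff_distrib sin_diff cos_diff)

lemma one_minus_cos_expansion:
  assumes p: "p < 2 * N" and \<delta>: "\<bar>\<delta>\<bar> < 1 / 2"
  shows "complex_of_real (1 - cos (\<delta> * grid N p)) =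
    (\<Sum>n<2 * N. complex_of_real ((-1) ^ n * cos_coeff N \<delta> n) * cis (real n * grid N p))"
proof -
  have N: "N > 0" using p by simp
  let ?F = "\<lambda>n. (\<Sum>m<2 * N. complex_of_real (cos (\<delta> * grid N m)) * cis (- (real n * grid N m))) / of_nat (2 * N)"
  have F: "?F n = - complex_of_real ((-1) ^ n * cos_coeff N \<delta> n)" if n: "n \<in> {0<..<2 * N}" for n
  proof -
    have n1: "1 \<le> real n" "real n \<le> 2 * real N - 1"
      using n by (auto simp flip: of_nat_Suc)
    have "complex_of_real (cos (\<delta> * grid N m)) =
       (cis (\<delta> * grid N m) + complex_of_real 1 * cis (- (\<delta> * grid N m))) / 2" for m
      by (simp add: cis_add_minus)
    then have "?F n = (\<Sum>m<2 * N. (cis (\<delta> * grid N m) + complex_of_real 1 * cis (- (\<delta> * grid N m)))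
        * cis (- (real n * grid N m))) / 2 / of_nat (2 * N)"
      by (simp only: sum_divide_distrib times_divide_eq_left)
    also have "\<dots> = complex_of_real (- 4 * real N * sin (pi * (\<delta> - real n)) * kadec_weight N \<delta> (real n)) / 2 / of_nat (2 * N)"
      using N n1 by (subst sum_grid_pair[OF N sin_sq_ne[OF N _ _ \<delta>]]) (auto simp: sin_pi_add_nat sin_pi_diff_nat)
    also have "\<dots> = - complex_of_real ((-1) ^ n * cos_coeff N \<delta> n)"
      using N n by (simp add: cos_coeff_def sin_pi_diff_nat)
    finally show ?thesis .
  qed
  have F0: "1 - ?F 0 = complex_of_real (cos_coeff N \<delta> 0)"
    using N by (simp add: cos_coeff_def sum_subtractf field_simps)
  have split: "{..<2 * N} = insert 0 {0<..<2 * N}" using N by auto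
  have "complex_of_real (cos (\<delta> * grid N p)) = (\<Sum>n<2 * N. ?F n * cis (real n * grid N p))"
    using grid_fourier_inversion[OF p, of "\<lambda>m. complex_of_real (cos (\<delta> * grid N m))" 0] by simp
  also have "\<dots> = ?F 0 + (\<Sum>n\<in>{0<..<2 * N}. ?F n * cis (real n * grid N p))"
    by (subst split, subst sum.insert) auto
  also have "(\<Sum>n\<in>{0<..<2 * N}. ?F n * cis (real n * grid N p)) =
     - (\<Sum>n\<in>{0<..<2 * N}. complex_of_real ((-1) ^ n * cos_coeff N \<delta> n) * cis (real n * grid N p))"
    unfolding sum_negf[symmetric] by (intro sum.cong refl) (simp only: F mult_minus_left)
  finally have "complex_of_real (1 - cos (\<delta> * grid N p)) = (1 - ?F 0) +
     (\<Sum>n\<in>{0<..<2 * N}. complex_of_real ((-1) ^ n * cos_coeff N \<delta> n) * cis (real n * grid N p))"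
    by simp
  also have "\<dots> = (\<Sum>n<2 * N. complex_of_real ((-1) ^ n * cos_coeff N \<delta> n) * cis (real n * grid N p))"
    unfolding F0 by (subst split, subst sum.insert) auto
  finally show ?thesis .
qed

lemma sin_expansion:
  assumes p: "p < 2 * N" and \<delta>: "\<bar>\<delta>\<bar> < 1 / 2"
  shows "\<i> * complex_of_real (sin (\<delta> * grid N p)) =
    (\<Sum>n<2 * N. complex_of_real ((-1) ^ n * sin_coeff N \<delta> n) * cis ((real n + 1 / 2) * grid N p))"
proof -
  have N: "N > 0" using p by simp
  let ?F = "\<lambda>n. (\<Sum>m<2 * N. \<i> * complex_of_real (sin (\<delta> * grid N m)) * cis (- ((real n + 1 / 2) * grid N m))) / of_nat (2 * N)"
  have F: "?F n = complex_of_real ((-1) ^ n * sin_coeff N \<delta> n)" if n: "n < 2 * N" for n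
  proof -
    have n1: "1 / 2 \<le> real n + 1 / 2" "real n + 1 / 2 \<le> 2 * real N - 1 / 2"
      using n by (auto simp: field_simps simp flip: of_nat_Suc)
    have sn: "sin (pi * (\<delta> - (real n + 1 / 2))) = - ((-1) ^ n * cos (pi * \<delta>))"
      "sin (pi * (\<delta> + (real n + 1 / 2))) = (-1) ^ n * cos (pi * \<delta>)"
    proof -
      have "pi * (\<delta> - (real n + 1 / 2)) = pi * (\<delta> - real n) - pi / 2"
        "pi * (\<delta> + (real n + 1 / 2)) = pi * (\<delta> + real n) + pi / 2"
        by (simp_all add: algebra_simps)
      then show "sin (pi * (\<delta> - (real n + 1 / 2))) = - ((-1) ^ n * cos (pi * \<delta>))"
        "sin (pi * (\<delta> + (real n + 1 / 2))) = (-1) ^ n * cos (pi * \<delta>)"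
        by (simp_all add: sin_diff sin_add sin_pi_add_nat sin_pi_diff_nat)
    qed
    have "\<i> * complex_of_real (sin (\<delta> * grid N m)) =
       (cis (\<delta> * grid N m) + complex_of_real (- 1) * cis (- (\<delta> * grid N m))) / 2" for m
      by (simp add: complex_eq_iff)
    then have "?F n = (\<Sum>m<2 * N. (cis (\<delta> * grid N m) + complex_of_real (- 1) * cis (- (\<delta> * grid N m)))
        * cis (- ((real n + 1 / 2) * grid N m))) / 2 / of_nat (2 * N)"
      by (simp only: sum_divide_distrib times_divide_eq_left)
    also have "\<dots> = complex_of_real (- 4 * real N * sin (pi * (\<delta> - (real n + 1 / 2)))
        * kadec_weight N \<delta> (real n + 1 / 2)) / 2 / of_nat (2 * N)"
      using N n1 by (subst sum_grid_pair[OF N sin_sq_ne[OF N _ _ \<delta>]]) (auto simp: sn)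
    also have "\<dots> = complex_of_real ((-1) ^ n * sin_coeff N \<delta> n)"
      using N by (simp add: sin_coeff_def sn)
    finally show ?thesis .
  qed
  have "\<i> * complex_of_real (sin (\<delta> * grid N p)) = (\<Sum>n<2 * N. ?F n * cis ((real n + 1 / 2) * grid N p))"
    by (rule grid_fourier_inversion[OF p])
  also have "\<dots> = (\<Sum>n<2 * N. complex_of_real ((-1) ^ n * sin_coeff N \<delta> n) * cis ((real n + 1 / 2) * grid N p))"
    by (intro sum.cong refl) (simp only: F lessThan_iff)
  finally show ?thesis .
qed

lemma cis_nat_pi: "cis (- (real n * pi)) = (-1) ^ n"
  by (simp add: complex_eq_iff power_minus_even)

text \<open>At the grid point \<open>- \<pi>\<close> the exponential \<open>cis (n x)\<close> equals \<open>(-1)\<^sup>n\<close> and cancels the alternating sign of the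
coefficients. The sum of the coefficients is therefore the value of the function there.\<close>

lemma sum_cos_coeff:
  assumes N: "N > 0" and \<delta>: "\<bar>\<delta>\<bar> < 1 / 2"
  shows "(\<Sum>n<2 * N. cos_coeff N \<delta> n) = 1 - cos (pi * \<delta>)"
proof -
  have g: "grid N 0 = - pi" using N by (simp add: grid_def)
  have "complex_of_real (1 - cos (\<delta> * - pi)) =
    (\<Sum>n<2 * N. complex_of_real ((-1) ^ n * cos_coeff N \<delta> n) * cis (real n * - pi))"
    using one_minus_cos_expansion[of 0 N \<delta>] N \<delta> by (simp only: g mult_pos_pos zero_less_numeral)
  also have "\<dots> = (\<Sum>n<2 * N. complex_of_real (cos_coeff N \<delta> n))"
  proof (intro sum.cong refl)
    fix n
    have "(-1) ^ n * ((-1) ^ n) = (1::complex)" by (simp flip: power_mult_distrib)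
    then show "complex_of_real ((-1) ^ n * cos_coeff N \<delta> n) * cis (real n * - pi) = complex_of_real (cos_coeff N \<delta> n)"
      using cis_nat_pi[of n] by (simp add: mult_ac)
  qed
  finally have "complex_of_real (1 - cos (pi * \<delta>)) = complex_of_real (\<Sum>n<2 * N. cos_coeff N \<delta> n)"
    by (simp add: mult.commute)
  then show ?thesis by (simp only: of_real_eq_iff)
qed

lemma sum_sin_coeff:
  assumes N: "N > 0" and \<delta>: "\<bar>\<delta>\<bar> < 1 / 2"
  shows "(\<Sum>n<2 * N. sin_coeff N \<delta> n) = sin (pi * \<delta>)"
proof -
  have g: "grid N 0 = - pi" using N by (simp add: grid_def)
  have "\<i> * complex_of_real (sin (\<delta> * - pi)) =
    (\<Sum>n<2 * N. complex_of_real ((-1) ^ n * sin_coeff N \<delta> n) * cis ((real n + 1 / 2) * - pi))"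
    using sin_expansion[of 0 N \<delta>] N \<delta> by (simp only: g mult_pos_pos zero_less_numeral)
  also have "\<dots> = (\<Sum>n<2 * N. - \<i> * complex_of_real (sin_coeff N \<delta> n))"
  proof (intro sum.cong refl)
    fix n
    have 1: "(-1) ^ n * ((-1) ^ n) = (1::complex)" by (simp flip: power_mult_distrib)
    have "cis ((real n + 1 / 2) * - pi) = cis (- (real n * pi)) * cis (- (pi / 2))"
      by (simp only: cis_mult) (simp add: algebra_simps)
    also have "\<dots> = (-1) ^ n * - \<i>" by (simp only: cis_nat_pi cis_minus_pi_half)
    finally have "complex_of_real ((-1) ^ n * sin_coeff N \<delta> n) * cis ((real n + 1 / 2) * - pi) =
       ((-1) ^ n * (-1) ^ n) * (- \<i> * complex_of_real (sin_coeff N \<delta> n))"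
      by (simp add: mult_ac)
    then show "complex_of_real ((-1) ^ n * sin_coeff N \<delta> n) * cis ((real n + 1 / 2) * - pi) =
      - \<i> * complex_of_real (sin_coeff N \<delta> n)"
      unfolding 1 by simp
  qed
  also have "\<dots> = - \<i> * complex_of_real (\<Sum>n<2 * N. sin_coeff N \<delta> n)"
    by (simp only: sum_distrib_left of_real_sum)
  finally have "complex_of_real (sin (pi * \<delta>)) = complex_of_real (\<Sum>n<2 * N. sin_coeff N \<delta> n)"
    by (simp add: mult.commute)
  then show ?thesis by (simp only: of_real_eq_iff)
qed

lemma kadec_weight_minus: "kadec_weight N (- \<delta>) \<nu> = - kadec_weight N \<delta> \<nu>"
  by (simp add: kadec_weight_def)

text \<open>The factor \<open>u\<close> stands for \<open>sin (\<pi> d)\<close> or \<open>cos (\<pi> d)\<close>, and \<open>v\<close> for its value at \<open>l\<close>. Since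
the denominator of the weight decreases in \<open>d\<close>, only the numerators have to be compared.\<close>

lemma kadec_weight_mono:
  assumes N: "N > 0" and \<nu>: "1 / 2 \<le> \<nu>" "\<nu> \<le> 2 * real N - 1 / 2" and d: "0 \<le> d" "d \<le> l" "l < 1 / 2"
    and u: "0 \<le> u" "u * sin (pi * d / real N) \<le> v * sin (pi * l / real N)"
  shows "0 \<le> u * kadec_weight N d \<nu>" "u * kadec_weight N d \<nu> \<le> v * kadec_weight N l \<nu>"
proof -
  note g = sin_sq_gap[OF N \<nu> d]
  have pos: "0 < 4 * real N * ((sin (pi * \<nu> / (2 * real N)))\<^sup>2 - (sin (pi * l / (2 * real N)))\<^sup>2)"
    using N g(1) by simp
  have le: "4 * real N * ((sin (pi * \<nu> / (2 * real N)))\<^sup>2 - (sin (pi * l / (2 * real N)))\<^sup>2)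
    \<le> 4 * real N * ((sin (pi * \<nu> / (2 * real N)))\<^sup>2 - (sin (pi * d / (2 * real N)))\<^sup>2)"
    using N g(2) by (intro mult_left_mono) auto
  have "0 \<le> u * sin (pi * d / real N)" using u(1) sin_pi_frac_mono(1)[OF N d] by simp
  then show "0 \<le> u * kadec_weight N d \<nu>" "u * kadec_weight N d \<nu> \<le> v * kadec_weight N l \<nu>"
    unfolding kadec_weight_def times_divide_eq_right using pos le u(2)
    by (auto intro!: divide_nonneg_nonneg frac_le simp del: mult_le_cancel_left)
qed

lemma cos_coeff_mono:
  assumes n: "n < 2 * N" and \<delta>: "\<bar>\<delta>\<bar> \<le> l" "l < 1 / 2"
  shows "\<bar>cos_coeff N \<delta> n\<bar> \<le> cos_coeff N l n"
proof -
  have N: "N > 0" using n by simp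
  have even: "cos_coeff N \<delta> n = cos_coeff N \<bar>\<delta>\<bar> n"
    by (cases "\<delta> \<ge> 0") (simp_all add: cos_coeff_def kadec_weight_minus)
  show ?thesis
  proof (cases "n = 0")
    case True
    \<comment> \<open>The mean value is monotone because each term is: the angles \<open>l x\<close> stay in \<open>[0, \<pi>]\<close> up to sign.\<close>
    have bounds: "0 \<le> 1 - cos (\<bar>\<delta>\<bar> * grid N m) \<and> 1 - cos (\<bar>\<delta>\<bar> * grid N m) \<le> 1 - cos (l * grid N m)"
      if m: "m < 2 * N" for m
    proof -
      have abs: "cos (c * grid N m) = cos (c * \<bar>grid N m\<bar>)" for c
        by (cases "grid N m \<ge> 0") simp_all
      have "\<bar>real m - real N\<bar> \<le> real N" using m by linarith
      then have g: "\<bar>grid N m\<bar> \<le> pi"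
        using N by (simp add: grid_def abs_mult divide_le_eq)
      have "l * \<bar>grid N m\<bar> \<le> 1 * pi" using g \<delta> by (intro mult_mono) auto
      then have "cos (l * \<bar>grid N m\<bar>) \<le> cos (\<bar>\<delta>\<bar> * \<bar>grid N m\<bar>)"
        using \<delta> by (intro cos_monotone_0_pi_le mult_right_mono) auto
      then show ?thesis unfolding abs[of "\<bar>\<delta>\<bar>"] abs[of l] by simp
    qed
    then have "0 \<le> (\<Sum>m<2 * N. 1 - cos (\<bar>\<delta>\<bar> * grid N m))"
      "(\<Sum>m<2 * N. 1 - cos (\<bar>\<delta>\<bar> * grid N m)) \<le> (\<Sum>m<2 * N. 1 - cos (l * grid N m))"
      by (auto intro!: sum_nonneg sum_mono simp del: abs_mult)
    then show ?thesis unfolding even unfolding cos_coeff_def using True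
      by (auto intro!: divide_right_mono simp: abs_of_nonneg)
  next
    case False
    have n1: "1 / 2 \<le> real n" "real n \<le> 2 * real N - 1 / 2"
      using n False by linarith+
    have s: "0 \<le> sin (pi * \<bar>\<delta>\<bar>)" "sin (pi * \<bar>\<delta>\<bar>) \<le> sin (pi * l)"
      using sin_pi_frac_mono[of 1 "\<bar>\<delta>\<bar>" l] \<delta> by auto
    have "sin (pi * \<bar>\<delta>\<bar>) * sin (pi * \<bar>\<delta>\<bar> / real N) \<le> sin (pi * l) * sin (pi * l / real N)"
      using s sin_pi_frac_mono[OF N, of "\<bar>\<delta>\<bar>" l] \<delta> by (intro mult_mono) auto
    from kadec_weight_mono[OF N n1 _ \<delta>(1,2) s(1) this] show ?thesis
      unfolding even using False by (simp add: cos_coeff_def)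
  qed
qed

lemma sin_coeff_mono:
  assumes n: "n < 2 * N" and \<delta>: "\<bar>\<delta>\<bar> \<le> l" "l \<le> 1 / 4"
  shows "\<bar>sin_coeff N \<delta> n\<bar> \<le> sin_coeff N l n"
proof -
  have N: "N > 0" using n by simp
  have odd: "\<bar>sin_coeff N \<delta> n\<bar> = \<bar>sin_coeff N \<bar>\<delta>\<bar> n\<bar>"
    by (cases "\<delta> \<ge> 0") (simp_all add: sin_coeff_def kadec_weight_minus)
  have n1: "1 / 2 \<le> real n + 1 / 2" "real n + 1 / 2 \<le> 2 * real N - 1 / 2"
    using n by linarith+
  have c: "0 \<le> cos (pi * \<bar>\<delta>\<bar>)" using \<delta> by (intro cos_ge_zero) (auto intro: order_trans[of _ 0])
  from kadec_weight_mono[OF N n1 _ \<delta>(1) _ c sin_frac_cos_mono[OF N _ \<delta>]] \<delta>(2)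
  show ?thesis unfolding odd by (simp add: sin_coeff_def)
qed


section \<open>Perturbation of the Fourier matrix\<close>

lemma L2_set_cmod_sum_le:
  "L2_set (\<lambda>j. cmod (\<Sum>n\<in>I. f n j)) J \<le> (\<Sum>n\<in>I. L2_set (\<lambda>j. cmod (f n j)) J)"
proof (induction I rule: infinite_finite_induct)
  case (insert n I)
  have "L2_set (\<lambda>j. cmod (\<Sum>n\<in>insert n I. f n j)) J \<le>
    L2_set (\<lambda>j. cmod (f n j) + cmod (\<Sum>n\<in>I. f n j)) J"
    using insert by (intro L2_set_mono) (auto simp: norm_triangle_ineq)
  also have "\<dots> \<le> L2_set (\<lambda>j. cmod (f n j)) J + L2_set (\<lambda>j. cmod (\<Sum>n\<in>I. f n j)) J"
    by (rule L2_set_triangle_ineq)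
  finally show ?case using insert by simp
qed (simp_all add: L2_set_def)

text \<open>The step that turns an expansion into an operator bound. Each term \<open>a n k * e n j\<close> separates the
row index from the column index, so it acts by a diagonal matrix with entries at most \<open>A n\<close> before \<open>b\<close>, and by a
contractive diagonal matrix after it.\<close>

lemma L2_set_multiplier_bound:
  fixes b g :: "'k \<Rightarrow> 'j \<Rightarrow> complex"
  assumes bound: "\<And>d. L2_set (\<lambda>j. cmod (\<Sum>k\<in>K. d k * b k j)) J \<le> M * L2_set (\<lambda>k. cmod (d k)) K"
    and M: "0 \<le> M"
    and g: "\<And>k j. k \<in> K \<Longrightarrow> j \<in> J \<Longrightarrow> g k j = (\<Sum>n\<in>I. a n k * e n j)"
    and e: "\<And>n j. cmod (e n j) \<le> 1"
    and a: "\<And>n k. n \<in> I \<Longrightarrow> k \<in> K \<Longrightarrow> cmod (a n k) \<le> A n"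
    and A: "\<And>n. n \<in> I \<Longrightarrow> 0 \<le> A n"
  shows "L2_set (\<lambda>j. cmod (\<Sum>k\<in>K. c k * (g k j * b k j))) J \<le> M * (\<Sum>n\<in>I. A n) * L2_set (\<lambda>k. cmod (c k)) K"
proof -
  let ?f = "\<lambda>n j. e n j * (\<Sum>k\<in>K. (c k * a n k) * b k j)"
  have "(\<Sum>k\<in>K. c k * (g k j * b k j)) = (\<Sum>n\<in>I. ?f n j)" if "j \<in> J" for j
  proof -
    have "(\<Sum>k\<in>K. c k * (g k j * b k j)) = (\<Sum>k\<in>K. \<Sum>n\<in>I. e n j * ((c k * a n k) * b k j))"
      using that by (intro sum.cong refl) (simp add: g sum_distrib_left sum_distrib_right mult_ac)
    then show ?thesis by (simp only: sum.swap[of _ I] sum_distrib_left)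
  qed
  then have "L2_set (\<lambda>j. cmod (\<Sum>k\<in>K. c k * (g k j * b k j))) J = L2_set (\<lambda>j. cmod (\<Sum>n\<in>I. ?f n j)) J"
    by (intro L2_set_cong) auto
  also have "\<dots> \<le> (\<Sum>n\<in>I. L2_set (\<lambda>j. cmod (?f n j)) J)"
    by (rule L2_set_cmod_sum_le)
  also have "\<dots> \<le> (\<Sum>n\<in>I. M * (A n * L2_set (\<lambda>k. cmod (c k)) K))"
  proof (rule sum_mono)
    fix n assume n: "n \<in> I"
    have "L2_set (\<lambda>j. cmod (?f n j)) J \<le> L2_set (\<lambda>j. cmod (\<Sum>k\<in>K. (c k * a n k) * b k j)) J"
      by (intro L2_set_mono) (auto simp: norm_mult intro!: mult_left_le_one_le e)
    also have "\<dots> \<le> M * L2_set (\<lambda>k. cmod (c k * a n k)) K"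
      by (rule bound)
    also have "\<dots> \<le> M * L2_set (\<lambda>k. cmod (c k) * A n) K"
      using n M by (intro mult_left_mono L2_set_mono) (auto simp: norm_mult intro!: mult_left_mono a)
    also have "\<dots> = M * (A n * L2_set (\<lambda>k. cmod (c k)) K)"
      using A[OF n] by (simp only: mult.commute[of "A n"] L2_set_left_distrib)
    finally show "L2_set (\<lambda>j. cmod (?f n j)) J \<le> M * (A n * L2_set (\<lambda>k. cmod (c k)) K)" .
  qed
  finally show ?thesis by (simp add: sum_distrib_left sum_distrib_right mult_ac)
qed

text \<open>For \<open>\<epsilon> = 0\<close> and centred exponents the Vandermonde matrix is \<open>sqrt N\<close> times a unitary matrix.\<close>

lemma fourier_matrix_isometry:
  "L2_set (\<lambda>j. cmod (\<Sum>k<N. d k * cis (real (Suc k) * grid N (2 * j + 1)))) {..<N}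
    = sqrt (real N) * L2_set (\<lambda>k. cmod (d k)) {..<N}"
proof -
  let ?b = "\<lambda>k j. cis (real (Suc k) * grid N (2 * j + 1))"
  have orth: "(\<Sum>j<N. ?b k j * cnj (?b k' j)) = (if k = k' then of_nat N else 0)"
    if k: "k < N" "k' < N" for k k'
  proof -
    have N: "N > 0" using k by simp
    have "?b k j * cnj (?b k' j) = cis ((real k - real k') * grid N 1)
       * cis (real j * (2 * pi * real_of_int (int k - int k') / real N))" for j
      unfolding cis_cnj cis_mult using N
      by (intro arg_cong[where f = cis]) (simp add: grid_def field_simps)
    then have "(\<Sum>j<N. ?b k j * cnj (?b k' j)) = cis ((real k - real k') * grid N 1)
       * (\<Sum>j<N. cis (real j * (2 * pi * real_of_int (int k - int k') / real N)))"
      by (simp only: sum_distrib_left)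
    also have "(\<Sum>j<N. cis (real j * (2 * pi * real_of_int (int k - int k') / real N))) =
       (if int k - int k' = 0 then of_nat N else 0)"
      using k by (intro sum_roots_of_unity) linarith
    finally show ?thesis by auto
  qed
  let ?S = "\<lambda>j. \<Sum>k<N. d k * ?b k j"
  have "complex_of_real (\<Sum>j<N. (cmod (?S j))\<^sup>2) = (\<Sum>j<N. ?S j * cnj (?S j))"
    by (simp only: of_real_sum complex_norm_square)
  also have "\<dots> = (\<Sum>j<N. \<Sum>k<N. \<Sum>k'<N. d k * cnj (d k') * (?b k j * cnj (?b k' j)))"
    by (simp only: cnj_sum sum_product complex_cnj_mult mult_ac)
  also have "\<dots> = (\<Sum>k<N. \<Sum>j<N. \<Sum>k'<N. d k * cnj (d k') * (?b k j * cnj (?b k' j)))"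
    by (rule sum.swap)
  also have "\<dots> = (\<Sum>k<N. \<Sum>k'<N. \<Sum>j<N. d k * cnj (d k') * (?b k j * cnj (?b k' j)))"
    by (intro sum.cong refl sum.swap)
  also have "\<dots> = (\<Sum>k<N. \<Sum>k'<N. if k = k' then d k * cnj (d k') * of_nat N else 0)"
    unfolding sum_distrib_left[symmetric] by (intro sum.cong refl) (subst orth, auto)
  also have "\<dots> = (\<Sum>k<N. of_nat N * (d k * cnj (d k)))"
    by (simp add: mult.commute)
  also have "\<dots> = complex_of_real (real N * (\<Sum>k<N. (cmod (d k))\<^sup>2))"
    by (simp only: sum_distrib_left of_real_mult of_real_sum complex_norm_square of_real_of_nat_eq)
  finally have "(\<Sum>j<N. (cmod (?S j))\<^sup>2) = real N * (\<Sum>k<N. (cmod (d k))\<^sup>2)"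
    by (simp only: of_real_eq_iff)
  then show ?thesis by (simp add: L2_set_def real_sqrt_mult)
qed

text \<open>Kadec's argument: split \<open>cis t - 1\<close> into \<open>\<i> sin t\<close> and \<open>1 - cos t\<close>, and bound the multiplier given by each
part by the sum of its coefficients at the worst perturbation \<open>l\<close>.\<close>

lemma perturbed_fourier_bound:
  assumes \<delta>: "\<And>k. k < N \<Longrightarrow> \<bar>\<delta> k\<bar> \<le> l" and l: "0 \<le> l" "l < 1 / 4"
  shows "L2_set (\<lambda>j. cmod (\<Sum>k<N. d k * ((cis (\<delta> k * grid N (2 * j + 1)) - 1)
      * cis (real (Suc k) * grid N (2 * j + 1))))) {..<N}
    \<le> sqrt (real N) * (1 - cos (pi * l) + sin (pi * l)) * L2_set (\<lambda>k. cmod (d k)) {..<N}"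
proof (cases "N = 0")
  case False
  then have N: "N > 0" by simp
  let ?x = "\<lambda>j. grid N (2 * j + 1)"
  let ?b = "\<lambda>k j. cis (real (Suc k) * ?x j)"
  let ?d = "L2_set (\<lambda>k. cmod (d k)) {..<N}"
  let ?C = "\<lambda>k j. complex_of_real (1 - cos (\<delta> k * ?x j))"
  let ?S = "\<lambda>k j. \<i> * complex_of_real (sin (\<delta> k * ?x j))"
  have l2: "\<bar>l\<bar> < 1 / 2" using l by auto
  have \<delta>2: "\<bar>\<delta> k\<bar> < 1 / 2" if "k < N" for k using \<delta>[OF that] l by simp
  have bound: "L2_set (\<lambda>j. cmod (\<Sum>k<N. c k * ?b k j)) {..<N} \<le> sqrt (real N) * L2_set (\<lambda>k. cmod (c k)) {..<N}" for c
    by (simp only: fourier_matrix_isometry)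
  have C: "L2_set (\<lambda>j. cmod (\<Sum>k<N. d k * (?C k j * ?b k j))) {..<N} \<le>
      sqrt (real N) * (\<Sum>n<2 * N. cos_coeff N l n) * ?d"
  proof (rule L2_set_multiplier_bound[OF bound])
    show "?C k j = (\<Sum>n<2 * N. complex_of_real ((-1) ^ n * cos_coeff N (\<delta> k) n) * cis (real n * ?x j))"
      if "k \<in> {..<N}" "j \<in> {..<N}" for k j
      using that by (intro one_minus_cos_expansion \<delta>2) auto
    show "cmod (complex_of_real ((-1) ^ n * cos_coeff N (\<delta> k) n)) \<le> cos_coeff N l n"
      if "n \<in> {..<2 * N}" "k \<in> {..<N}" for n k
      using cos_coeff_mono[of n N "\<delta> k" l] that \<delta> l by (simp add: norm_mult norm_power)
    show "0 \<le> cos_coeff N l n" if "n \<in> {..<2 * N}" for n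
      using cos_coeff_mono[of n N l l] that l by simp
  qed simp_all
  have S: "L2_set (\<lambda>j. cmod (\<Sum>k<N. d k * (?S k j * ?b k j))) {..<N} \<le>
      sqrt (real N) * (\<Sum>n<2 * N. sin_coeff N l n) * ?d"
  proof (rule L2_set_multiplier_bound[OF bound])
    show "?S k j = (\<Sum>n<2 * N. complex_of_real ((-1) ^ n * sin_coeff N (\<delta> k) n) * cis ((real n + 1 / 2) * ?x j))"
      if "k \<in> {..<N}" "j \<in> {..<N}" for k j
      using that by (intro sin_expansion \<delta>2) auto
    show "cmod (complex_of_real ((-1) ^ n * sin_coeff N (\<delta> k) n)) \<le> sin_coeff N l n"
      if "n \<in> {..<2 * N}" "k \<in> {..<N}" for n k
      using sin_coeff_mono[of n N "\<delta> k" l] that \<delta> l by (simp add: norm_mult norm_power)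
    show "0 \<le> sin_coeff N l n" if "n \<in> {..<2 * N}" for n
      using sin_coeff_mono[of n N l l] that l by simp
  qed simp_all
  have "cis t - 1 = \<i> * complex_of_real (sin t) - complex_of_real (1 - cos t)" for t
    by (simp add: complex_eq_iff)
  then have split: "(\<Sum>k<N. d k * ((cis (\<delta> k * ?x j) - 1) * ?b k j)) =
      (\<Sum>k<N. d k * (?S k j * ?b k j)) - (\<Sum>k<N. d k * (?C k j * ?b k j))" for j
    by (simp only: left_diff_distrib right_diff_distrib sum_subtractf)
  have "L2_set (\<lambda>j. cmod (\<Sum>k<N. d k * ((cis (\<delta> k * ?x j) - 1) * ?b k j))) {..<N} \<le>
    L2_set (\<lambda>j. cmod (\<Sum>k<N. d k * (?S k j * ?b k j)) + cmod (\<Sum>k<N. d k * (?C k j * ?b k j))) {..<N}"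
    unfolding split by (intro L2_set_mono norm_triangle_ineq4) simp
  also have "\<dots> \<le> L2_set (\<lambda>j. cmod (\<Sum>k<N. d k * (?S k j * ?b k j))) {..<N} +
      L2_set (\<lambda>j. cmod (\<Sum>k<N. d k * (?C k j * ?b k j))) {..<N}"
    by (rule L2_set_triangle_ineq)
  also have "\<dots> \<le> sqrt (real N) * sin (pi * l) * ?d + sqrt (real N) * (1 - cos (pi * l)) * ?d"
    using add_mono[OF S C] by (simp only: sum_sin_coeff[OF N l2] sum_cos_coeff[OF N l2])
  finally show ?thesis by (simp add: algebra_simps)
qed simp

text \<open>Centring the exponents: \<open>2 \<pi> j / N\<close> equals the grid point numbered \<open>2j + 1\<close> plus
\<open>\<pi> (N - 1) / N\<close>. The extra phase depends on the column only. Centring matters because Kadec's expansions hold on an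
interval symmetric about \<open>0\<close>.\<close>

lemma vandermonde_entry:
  assumes N: "N > 0"
  shows "exp (2 * complex_of_real pi * \<i> * complex_of_real (real (Suc k) + e) / of_nat N) ^ j =
    cis (pi * (real N - 1) * (real (Suc k) + e) / real N)
    * (cis (e * grid N (2 * j + 1)) * cis (real (Suc k) * grid N (2 * j + 1)))"
proof -
  have "exp (2 * complex_of_real pi * \<i> * complex_of_real (real (Suc k) + e) / of_nat N)
      = cis (2 * pi * (real (Suc k) + e) / real N)"
    by (simp add: cis_conv_exp mult_ac)
  also have "\<dots> ^ j = cis (real j * (2 * pi * (real (Suc k) + e) / real N))"
    by (rule DeMoivre)
  also have "real j * (2 * pi * (real (Suc k) + e) / real N) =
     pi * (real N - 1) * (real (Suc k) + e) / real N + (e * grid N (2 * j + 1) + real (Suc k) * grid N (2 * j + 1))"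
    using N by (simp add: grid_def field_simps)
  finally show ?thesis by (simp only: cis_mult)
qed

lemma vandermonde_norm_bounds:
  assumes N: "N > 0" and e: "\<And>k. k \<in> {1..N} \<Longrightarrow> \<bar>\<epsilon> k\<bar> \<le> l" and l: "0 \<le> l" "l < 1 / 4"
    and z: "\<And>k. k \<in> {1..N} \<Longrightarrow>
           z k = exp (2 * complex_of_real pi * \<i> * complex_of_real (real k + \<epsilon> k) / of_nat N)"
  shows "sqrt (real N) * (cos (pi * l) - sin (pi * l)) * L2_set (\<lambda>k. cmod (c k)) {..<N}
      \<le> L2_set (\<lambda>j. cmod (\<Sum>k<N. z (Suc k) ^ j * c k)) {..<N}"
    and "L2_set (\<lambda>j. cmod (\<Sum>k<N. z (Suc k) ^ j * c k)) {..<N}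
      \<le> sqrt (real N) * (2 - cos (pi * l) + sin (pi * l)) * L2_set (\<lambda>k. cmod (c k)) {..<N}"
proof -
  let ?x = "\<lambda>j. grid N (2 * j + 1)"
  \<comment> \<open>The column phases are absorbed into the coefficients, which does not change their moduli.\<close>
  define d where "d k = c k * cis (pi * (real N - 1) * (real (Suc k) + \<epsilon> (Suc k)) / real N)" for k
  let ?u = "\<lambda>j. \<Sum>k<N. d k * cis (real (Suc k) * ?x j)"
  let ?r = "\<lambda>j. \<Sum>k<N. d k * ((cis (\<epsilon> (Suc k) * ?x j) - 1) * cis (real (Suc k) * ?x j))"
  let ?v = "\<lambda>j. \<Sum>k<N. z (Suc k) ^ j * c k"
  let ?n = "\<lambda>f. L2_set (\<lambda>j. cmod (f j :: complex)) {..<N}"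
  have v: "?v j = ?u j + ?r j" for j
    unfolding sum.distrib[symmetric]
    by (intro sum.cong refl) (subst z, simp, subst vandermonde_entry[OF N], simp add: d_def algebra_simps)
  have nd: "?n d = ?n c" by (simp add: d_def norm_mult)
  have u: "?n ?u = sqrt (real N) * ?n c"
    unfolding nd[symmetric] by (rule fourier_matrix_isometry)
  have r: "?n ?r \<le> sqrt (real N) * (1 - cos (pi * l) + sin (pi * l)) * ?n c"
    unfolding nd[symmetric] by (rule perturbed_fourier_bound) (use e l in auto)
  have "?n ?v \<le> L2_set (\<lambda>j. cmod (?u j) + cmod (?r j)) {..<N}"
    unfolding v by (intro L2_set_mono norm_triangle_ineq) simp
  also have "\<dots> \<le> ?n ?u + ?n ?r" by (rule L2_set_triangle_ineq)
  finally show "?n ?v \<le> sqrt (real N) * (2 - cos (pi * l) + sin (pi * l)) * ?n c"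
    using u r by (simp add: algebra_simps)
  have "?n ?u \<le> L2_set (\<lambda>j. cmod (?v j) + cmod (?r j)) {..<N}"
  proof (intro L2_set_mono)
    fix j
    have "?u j = ?v j - ?r j" unfolding v by simp
    then show "cmod (?u j) \<le> cmod (?v j) + cmod (?r j)" by (simp only: norm_triangle_ineq4)
  qed simp
  also have "\<dots> \<le> ?n ?v + ?n ?r" by (rule L2_set_triangle_ineq)
  finally show "sqrt (real N) * (cos (pi * l) - sin (pi * l)) * ?n c \<le> ?n ?v"
    using u r by (simp add: algebra_simps)
qed

section \<open>Norm bounds and extreme singular values\<close>

lemma mult_mat_vec_nth:
  fixes A :: "complex mat"
  assumes "A \<in> carrier_mat m n" "v \<in> carrier_vec n" "i < m"
  shows "(A *\<^sub>v v) $ i = (\<Sum>j<n. A $$ (i, j) * v $ j)"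
  using assms by (auto simp: scalar_prod_def lessThan_atLeast0)

lemma mat_adjoint_nth:
  fixes A :: "complex mat"
  assumes "A \<in> carrier_mat m n" "i < n" "j < m"
  shows "mat_adjoint A $$ (i, j) = cnj (A $$ (j, i))"
  using assms unfolding mat_adjoint_def by (simp add: mat_of_rows_def)

text \<open>If \<open>v\<close> is an eigenvector of \<open>A\<^sup>* A\<close> for \<open>s\<^sup>2\<close>, then \<open>\<parallel>A v\<parallel>\<^sup>2\<close> is the inner product of \<open>A\<^sup>* A v\<close>
with \<open>v\<close>, that is, \<open>s\<^sup>2 \<parallel>v\<parallel>\<^sup>2\<close>.\<close>

lemma singular_value_vector:
  assumes A: "A \<in> carrier_mat m n" and s: "s \<in> singular_values A"
  obtains v where "v \<in> carrier_vec n" "v \<noteq> 0\<^sub>v n"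
    "L2_set (\<lambda>j. cmod ((A *\<^sub>v v) $ j)) {..<m} = s * L2_set (\<lambda>i. cmod (v $ i)) {..<n}"
proof -
  let ?H = "mat_adjoint A"
  have H: "?H \<in> carrier_mat n m" using A unfolding mat_adjoint_def by auto
  from s have s0: "0 \<le> s" and "eigenvalue (?H * A) (complex_of_real (s\<^sup>2))"
    by (auto simp: singular_values_def)
  then obtain v where "eigenvector (?H * A) v (complex_of_real (s\<^sup>2))"
    by (auto simp: eigenvalue_def)
  then have v: "v \<in> carrier_vec n" "v \<noteq> 0\<^sub>v n" and "(?H * A) *\<^sub>v v = complex_of_real (s\<^sup>2) \<cdot>\<^sub>v v"
    using H by (simp_all add: eigenvector_def)
  then have eq: "?H *\<^sub>v (A *\<^sub>v v) = complex_of_real (s\<^sup>2) \<cdot>\<^sub>v v"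
    using A H by (simp add: assoc_mult_mat_vec)
  define w where "w = A *\<^sub>v v"
  have w: "w \<in> carrier_vec m" using A v by (auto simp: w_def)
  have wi: "w $ j = (\<Sum>i<n. A $$ (j, i) * v $ i)" if "j < m" for j
    unfolding w_def by (rule mult_mat_vec_nth[OF A v(1) that])
  have Hw: "(\<Sum>j<m. cnj (A $$ (j, i)) * w $ j) = complex_of_real (s\<^sup>2) * v $ i" if "i < n" for i
  proof -
    have "(\<Sum>j<m. cnj (A $$ (j, i)) * w $ j) = (?H *\<^sub>v w) $ i"
      unfolding mult_mat_vec_nth[OF H w that]
      by (intro sum.cong refl) (simp add: mat_adjoint_nth[OF A that])
    then show ?thesis using that v by (simp add: w_def eq)
  qed
  have "complex_of_real (\<Sum>j<m. (cmod (w $ j))\<^sup>2) = (\<Sum>j<m. cnj (w $ j) * w $ j)"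
    unfolding of_real_sum complex_norm_square by (simp add: mult.commute)
  also have "\<dots> = (\<Sum>j<m. \<Sum>i<n. cnj (v $ i) * (cnj (A $$ (j, i)) * w $ j))"
    by (rule sum.cong) (simp_all add: wi sum_distrib_right sum_distrib_left mult_ac)
  also have "\<dots> = (\<Sum>i<n. cnj (v $ i) * (\<Sum>j<m. cnj (A $$ (j, i)) * w $ j))"
    by (subst sum.swap) (simp only: sum_distrib_left)
  also have "\<dots> = (\<Sum>i<n. cnj (v $ i) * (complex_of_real (s\<^sup>2) * v $ i))"
    by (rule sum.cong) (simp_all only: Hw lessThan_iff)
  also have "\<dots> = complex_of_real (s\<^sup>2 * (\<Sum>i<n. (cmod (v $ i))\<^sup>2))"
    unfolding of_real_mult of_real_sum complex_norm_square sum_distrib_left by (simp add: mult_ac)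
  finally have "(\<Sum>j<m. (cmod (w $ j))\<^sup>2) = s\<^sup>2 * (\<Sum>i<n. (cmod (v $ i))\<^sup>2)"
    by (simp only: of_real_eq_iff)
  then have "L2_set (\<lambda>j. cmod (w $ j)) {..<m} = s * L2_set (\<lambda>i. cmod (v $ i)) {..<n}"
    using s0 by (simp add: L2_set_def real_sqrt_mult)
  then show thesis using that v by (simp add: w_def)
qed

lemma L2_set_vec_pos:
  fixes v :: "complex vec"
  assumes "v \<in> carrier_vec n" "v \<noteq> 0\<^sub>v n"
  shows "0 < L2_set (\<lambda>i. cmod (v $ i)) {..<n}"
proof (rule ccontr)
  assume "\<not> ?thesis"
  then have "L2_set (\<lambda>i. cmod (v $ i)) {..<n} = 0" by (simp add: order_antisym not_less)
  then have "\<forall>i<n. v $ i = 0" by (simp add: L2_set_eq_0_iff)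
  then have "v = 0\<^sub>v n" using assms by (intro eq_vecI) auto
  with assms show False by simp
qed

lemma invertible_mat_of_trivial_kernel:
  fixes A :: "'a :: field mat"
  assumes A: "A \<in> carrier_mat n n"
    and inj: "\<And>v. v \<in> carrier_vec n \<Longrightarrow> A *\<^sub>v v = 0\<^sub>v n \<Longrightarrow> v = 0\<^sub>v n"
  shows "invertible_mat A"
proof -
  have "det A \<noteq> 0" using det_0_iff_vec_prod_zero[OF A] inj by blast
  then obtain B where "B \<in> carrier_mat n n" "B * A = 1\<^sub>m n" "A * B = 1\<^sub>m n"
    using det_non_zero_imp_unit[OF A, of "()"] by (auto simp: Units_def ring_mat_def)
  then show ?thesis using A unfolding invertible_mat_def inverts_mat_def by auto
qed

lemma singular_value_bounds_of_norm_bounds: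
  fixes A :: "complex mat"
  assumes A: "A \<in> carrier_mat n n" and n: "n > 0" and L: "0 < L"
    and lower: "\<And>v. v \<in> carrier_vec n \<Longrightarrow>
      L * L2_set (\<lambda>i. cmod (v $ i)) {..<n} \<le> L2_set (\<lambda>i. cmod ((A *\<^sub>v v) $ i)) {..<n}"
    and upper: "\<And>v. v \<in> carrier_vec n \<Longrightarrow>
      L2_set (\<lambda>i. cmod ((A *\<^sub>v v) $ i)) {..<n} \<le> U * L2_set (\<lambda>i. cmod (v $ i)) {..<n}"
  shows "invertible_mat A" "L \<le> smallest_singular_value A" "largest_singular_value A \<le> U"
proof -
  show "invertible_mat A"
  proof (rule invertible_mat_of_trivial_kernel[OF A], rule ccontr)
    fix v assume v: "v \<in> carrier_vec n" "A *\<^sub>v v = 0\<^sub>v n" "v \<noteq> 0\<^sub>v n"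
    have "L2_set (\<lambda>i. cmod ((A *\<^sub>v v) $ i)) {..<n} = 0"
      unfolding v(2) by (intro L2_set_0') auto
    then show False
      using lower[OF v(1)] mult_pos_pos[OF L L2_set_vec_pos[OF v(1,3)]] by simp
  qed
  have "L \<le> s \<and> s \<le> U" if "s \<in> singular_values A" for s
  proof -
    obtain v where v: "v \<in> carrier_vec n" "v \<noteq> 0\<^sub>v n"
      and eq: "L2_set (\<lambda>j. cmod ((A *\<^sub>v v) $ j)) {..<n} = s * L2_set (\<lambda>i. cmod (v $ i)) {..<n}"
      using singular_value_vector[OF A \<open>s \<in> _\<close>] .
    show ?thesis
      using lower[OF v(1)] upper[OF v(1)] L2_set_vec_pos[OF v] unfolding eq by simp
  qed
  then show "L \<le> smallest_singular_value A" "largest_singular_value A \<le> U"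
    unfolding smallest_singular_value_def largest_singular_value_def
    using finite_singular_values[OF A] singular_values_nonempty[OF A n] by auto
qed

theorem theorem1p2:
  fixes N :: nat and \<epsilon> :: "nat \<Rightarrow> real" and l :: real
    and z :: "nat \<Rightarrow> complex" and V :: "complex mat"
  assumes "N \<ge> 1"
    and "l = (MAX k\<in>{1..N}. \<bar>\<epsilon> k\<bar>)" and "l < 1 / 4"
    and "\<And>k. k \<in> {1..N} \<Longrightarrow>
           z k = exp (2 * complex_of_real pi * \<i> * complex_of_real (real k + \<epsilon> k) / of_nat N)"
    and "V = vandermonde_mat N z"
  shows "invertible_mat V
    \<and> smallest_singular_value V \<ge> sqrt (real N) * (cos (pi * l) - sin (pi * l))
    \<and> largest_singular_value V \<le> sqrt (real N) * (2 - cos (pi * l) + sin (pi * l))"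
proof -
  have N: "N > 0" using assms(1) by simp
  have \<epsilon>: "\<bar>\<epsilon> k\<bar> \<le> l" if "k \<in> {1..N}" for k
    unfolding assms(2) using that by (intro Max_ge) auto
  from \<epsilon>[of 1] have l: "0 \<le> l" using assms(1) by simp
  note bounds = vandermonde_norm_bounds[OF N \<epsilon> l assms(3,4)]
  have V: "V \<in> carrier_mat N N" by (simp add: assms(5) vandermonde_mat_def)
  have Vv: "L2_set (\<lambda>j. cmod ((V *\<^sub>v v) $ j)) {..<N} = L2_set (\<lambda>j. cmod (\<Sum>k<N. z (Suc k) ^ j * v $ k)) {..<N}"
    if "v \<in> carrier_vec N" for v
    by (intro L2_set_cong refl arg_cong[where f = cmod])
      (simp only: lessThan_iff mult_mat_vec_nth[OF V that], simp add: assms(5) vandermonde_mat_def)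
  have "sin (pi * l) < sin (pi / 4)"
    using l assms(3) by (intro sin_monotone_2pi) (auto intro: order_trans[of _ 0])
  also have "\<dots> = cos (pi / 4)" by (simp add: sin_45 cos_45)
  also have "\<dots> \<le> cos (pi * l)"
    using l assms(3) by (intro cos_monotone_0_pi_le) auto
  finally have "0 < sqrt (real N) * (cos (pi * l) - sin (pi * l))" using N by simp
  moreover have "sqrt (real N) * (cos (pi * l) - sin (pi * l)) * L2_set (\<lambda>i. cmod (v $ i)) {..<N}
      \<le> L2_set (\<lambda>i. cmod ((V *\<^sub>v v) $ i)) {..<N}" if "v \<in> carrier_vec N" for v
    unfolding Vv[OF that] by (rule bounds(1))
  moreover have "L2_set (\<lambda>i. cmod ((V *\<^sub>v v) $ i)) {..<N}
      \<le> sqrt (real N) * (2 - cos (pi * l) + sin (pi * l)) * L2_set (\<lambda>i. cmod (v $ i)) {..<N}"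
    if "v \<in> carrier_vec N" for v
    unfolding Vv[OF that] by (rule bounds(2))
  ultimately show ?thesis
    using singular_value_bounds_of_norm_bounds[OF V N] by blast
qed

end
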